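(* Let $X_1\sim\mathrm{Bin}(n_1,p_1)$ and $X_2\sim\mathrm{Bin}(n_2,p_2)$ be independent with $p_1,p_2\in[0,1]$, and put $\hat p_i=X_i/n_i$, $\hat p=\hat p_1-\hat p_2$ and $\widehat{\mathrm{Var}}[\hat p]=\frac{\hat p_1(1-\hat p_1)}{n_1}+\frac{\hat p_2(1-\hat p_2)}{n_2}$ (the Wald variance estimator). Then, exactly and for all $n_1,n_2\ge1$, $$\mathbb E\bigl[\widehat{\mathrm{Var}}[\hat p]\bigr]=\mathrm{Var}[\hat p]-\left(\frac{p_1(1-p_1)}{n_1^2}+\frac{p_2(1-p_2)}{n_2^2}\right)<\mathrm{Var}[\hat p],$$ and in the balanced design $n_1=n_2=n$ this reduces to $\mathbb E\bigl[\widehat{\mathrm{Var}}[\hat p]\bigr]=(1-1/n)\,\mathrm{Var}[\hat p]$.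
   Context: $\mathrm{Var}[\hat p]=\frac{p_1(1-p_1)}{n_1}+\frac{p_2(1-p_2)}{n_2}$ is the true variance of $\hat p$; $n_1,n_2$ are integer sample sizes.
   Formalization: The strict inequality is stated only when at least one of p_1, p_2 is not in {0,1}; if both are 0 or 1, then both sides equal 0 and strictness fails. The identities hold for all p_1, p_2 in [0,1]. *)

theory Defs
  imports "HOL-Probability.Probability"
begin

definition prop_diff ::
    "nat \<Rightarrow> nat \<Rightarrow> ('a \<Rightarrow> nat) \<Rightarrow> ('a \<Rightarrow> nat) \<Rightarrow> 'a \<Rightarrow> real" where
  "prop_diff n\<^sub>1 n\<^sub>2 X\<^sub>1 X\<^sub>2 \<omega> = real (X\<^sub>1 \<omega>) / real n\<^sub>1 - real (X\<^sub>2 \<omega>) / real n\<^sub>2"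

definition wald_var ::
    "nat \<Rightarrow> nat \<Rightarrow> ('a \<Rightarrow> nat) \<Rightarrow> ('a \<Rightarrow> nat) \<Rightarrow> 'a \<Rightarrow> real" where
  "wald_var n\<^sub>1 n\<^sub>2 X\<^sub>1 X\<^sub>2 \<omega> =
     (let q\<^sub>1 = real (X\<^sub>1 \<omega>) / real n\<^sub>1; q\<^sub>2 = real (X\<^sub>2 \<omega>) / real n\<^sub>2
      in q\<^sub>1 * (1 - q\<^sub>1) / real n\<^sub>1 + q\<^sub>2 * (1 - q\<^sub>2) / real n\<^sub>2)"

end

theory Submission
  imports Defs
begin

text \<open>
  Everything reduces to the first two moments of a single sample proportion \<open>q = X / n\<close> with
  \<open>X\<close> binomial: \<open>E q = p\<close> and \<open>E (q\<^sup>2) = p\<^sup>2 + p (1 - p) / n\<close>. The estimator replaces \<open>p (1 - p)\<close>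
  by \<open>q (1 - q) = q - q\<^sup>2\<close>, which is strictly concave, so by Jensen it falls short in the mean
  unless \<open>q\<close> is constant, and the shortfall is exactly the variance of \<open>q\<close>:
  \<open>E (q - q\<^sup>2) = p (1 - p) - p (1 - p) / n\<close>. Division by \<open>n\<close> turns this deficit
  into the bias \<open>- p (1 - p) / n\<^sup>2\<close> of one group (\<open>expectation_wald_var_one_sample\<close>).

  The estimator is a sum over the two groups, so the two biases add by linearity of expectation.
  The true variance splits in the same way because independence removes the covariance
  (\<open>variance_diff_indep\<close>). The total bias is negative as soon as one group is nondegenerate,
  and for equal sample sizes it is \<open>- 1 / n\<close> times the true variance.
\<close>

text \<open>
  For \<open>p \<in> {0..1}\<close> the moments are sums against the Bernstein basis polynomials, since
  \<open>pmf (binomial_pmf n p) k = Bernstein n k p\<close>. The second one is obtained through the factorial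
  moment \<open>E (X (X - 1)) = n (n - 1) p\<^sup>2\<close>.
\<close>

lemma binomial_pmf_moments:
  assumes "p \<in> {0..1}"
  shows expectation_binomial_pmf: "measure_pmf.expectation (binomial_pmf n p) real = real n * p"
    and expectation_binomial_pmf_square:
      "measure_pmf.expectation (binomial_pmf n p) (\<lambda>k. (real k)\<^sup>2)
         = (real n * p)\<^sup>2 + real n * p * (1 - p)"
proof -
  have sum: "measure_pmf.expectation (binomial_pmf n p) f = (\<Sum>k\<le>n. f k * Bernstein n k p)"
    for f :: "nat \<Rightarrow> real"
    by (simp add: expectation_binomial_pmf'[OF assms] Bernstein_def mult_ac)
  show mean: "measure_pmf.expectation (binomial_pmf n p) real = real n * p"
    by (simp add: sum)
  have "(\<lambda>k. (real k)\<^sup>2) = (\<lambda>k. real k * (real k - 1) + real k)"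
    by (simp add: fun_eq_iff power2_eq_square algebra_simps)
  then have "measure_pmf.expectation (binomial_pmf n p) (\<lambda>k. (real k)\<^sup>2)
      = (\<Sum>k\<le>n. real k * (real k - 1) * Bernstein n k p) + (\<Sum>k\<le>n. real k * Bernstein n k p)"
    by (simp add: sum distrib_right sum.distrib)
  also have "\<dots> = (real n * p)\<^sup>2 + real n * p * (1 - p)"
    by (simp only: sum_kk_Bernstein sum_k_Bernstein) (simp add: power2_eq_square algebra_simps)
  finally show "measure_pmf.expectation (binomial_pmf n p) (\<lambda>k. (real k)\<^sup>2)
      = (real n * p)\<^sup>2 + real n * p * (1 - p)" .
qed

context prob_space
begin

lemma variance_diff_indep:
  fixes X Y :: "'a \<Rightarrow> real"
  assumes indep: "indep_var borel X borel Y"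
    and [simp]: "integrable M X" "integrable M Y"
    and [simp]: "integrable M (\<lambda>\<omega>. (X \<omega>)\<^sup>2)" "integrable M (\<lambda>\<omega>. (Y \<omega>)\<^sup>2)"
  shows "variance (\<lambda>\<omega>. X \<omega> - Y \<omega>) = variance X + variance Y"
proof -
  have [simp]: "integrable M (\<lambda>\<omega>. X \<omega> * Y \<omega>)"
    by (intro indep_var_integrable indep) simp_all
  have prod: "expectation (\<lambda>\<omega>. X \<omega> * Y \<omega>) = expectation X * expectation Y"
    by (intro indep_var_lebesgue_integral indep) simp_all
  have square: "(\<lambda>\<omega>. (X \<omega> - Y \<omega>)\<^sup>2) = (\<lambda>\<omega>. (X \<omega>)\<^sup>2 + (Y \<omega>)\<^sup>2 - 2 * (X \<omega> * Y \<omega>))"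
    by (simp add: fun_eq_iff power2_eq_square algebra_simps)
  have "variance (\<lambda>\<omega>. X \<omega> - Y \<omega>)
      = expectation (\<lambda>\<omega>. (X \<omega> - Y \<omega>)\<^sup>2) - (expectation (\<lambda>\<omega>. X \<omega> - Y \<omega>))\<^sup>2"
    by (intro variance_eq) (simp_all add: square)
  also have "\<dots> = variance X + variance Y"
    by (simp add: square variance_eq prod) (simp add: power2_eq_square algebra_simps)
  finally show ?thesis .
qed

context
  fixes X :: "'a \<Rightarrow> nat" and n :: nat and p :: real
  assumes rv: "X \<in> measurable M (count_space UNIV)"
    and binomial: "distr M (count_space UNIV) X = measure_pmf (binomial_pmf n p)"
    and p: "p \<in> {0..1}"
begin

text \<open>
  The range of \<open>X\<close> need not be bounded on all of \<open>space M\<close>, but its distribution has finite support; this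
  settles all integrability questions below.
\<close>

lemma integrable_binomial_distributed:
  fixes f :: "nat \<Rightarrow> real"
  shows "integrable M (\<lambda>\<omega>. f (X \<omega>))"
proof -
  have "integrable (distr M (count_space UNIV) X) f"
    unfolding binomial using p by simp
  then show ?thesis
    by (subst (asm) integrable_distr_eq[OF rv]) simp_all
qed

lemma expectation_binomial_distributed:
  fixes f :: "nat \<Rightarrow> real"
  shows "expectation (\<lambda>\<omega>. f (X \<omega>)) = measure_pmf.expectation (binomial_pmf n p) f"
  by (simp flip: binomial add: integral_distr[OF rv])

context
  assumes n: "n \<ge> 1"
begin

lemma expectation_sample_proportion: "expectation (\<lambda>\<omega>. real (X \<omega>) / real n) = p"
  using n by (simp add: expectation_binomial_distributed[of real] expectation_binomial_pmf[OF p])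

lemma expectation_sample_proportion_square:
  "expectation (\<lambda>\<omega>. (real (X \<omega>) / real n)\<^sup>2) = p\<^sup>2 + p * (1 - p) / real n"
  using n
  by (simp add: power_divide expectation_binomial_distributed[of "\<lambda>k. (real k)\<^sup>2"]
      expectation_binomial_pmf_square[OF p])
     (simp add: power2_eq_square field_simps)

lemma variance_sample_proportion:
  "variance (\<lambda>\<omega>. real (X \<omega>) / real n) = p * (1 - p) / real n"
proof -
  have "variance (\<lambda>\<omega>. real (X \<omega>) / real n)
      = expectation (\<lambda>\<omega>. (real (X \<omega>) / real n)\<^sup>2) - (expectation (\<lambda>\<omega>. real (X \<omega>) / real n))\<^sup>2"
    by (intro variance_eq integrable_binomial_distributed[of "\<lambda>k. real k / real n"]
        integrable_binomial_distributed[of "\<lambda>k. (real k / real n)\<^sup>2"])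
  then show ?thesis
    unfolding expectation_sample_proportion expectation_sample_proportion_square by simp
qed

text \<open>With \<open>q = X / n\<close>, \<open>E (q (1 - q)) = E q - (E q)\<^sup>2 - Var q = p (1 - p) - Var q\<close>.\<close>

lemma expectation_wald_var_one_sample:
  "expectation (\<lambda>\<omega>. real (X \<omega>) / real n * (1 - real (X \<omega>) / real n) / real n)
     = p * (1 - p) / real n - p * (1 - p) / (real n)\<^sup>2"
proof -
  let ?q = "\<lambda>\<omega>. real (X \<omega>) / real n"
  have "(\<lambda>\<omega>. ?q \<omega> * (1 - ?q \<omega>) / real n) = (\<lambda>\<omega>. (?q \<omega> - (?q \<omega>)\<^sup>2) / real n)"
    by (simp add: fun_eq_iff power2_eq_square right_diff_distrib)
  then have "expectation (\<lambda>\<omega>. ?q \<omega> * (1 - ?q \<omega>) / real n)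
      = expectation (\<lambda>\<omega>. ?q \<omega> - (?q \<omega>)\<^sup>2) / real n"
    by simp
  also have "expectation (\<lambda>\<omega>. ?q \<omega> - (?q \<omega>)\<^sup>2) = expectation ?q - expectation (\<lambda>\<omega>. (?q \<omega>)\<^sup>2)"
    by (intro Bochner_Integration.integral_diff
        integrable_binomial_distributed[of "\<lambda>k. real k / real n"]
        integrable_binomial_distributed[of "\<lambda>k. (real k / real n)\<^sup>2"])
  also have "(expectation ?q - expectation (\<lambda>\<omega>. (?q \<omega>)\<^sup>2)) / real n
      = p * (1 - p) / real n - p * (1 - p) / (real n)\<^sup>2"
    unfolding expectation_sample_proportion expectation_sample_proportion_square
    using n by (simp add: power2_eq_square field_simps)
  finally show ?thesis .
qed

end

end

end

theorem proposition5:
  fixes M :: "'a measure" and X\<^sub>1 X\<^sub>2 :: "'a \<Rightarrow> nat"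
    and n\<^sub>1 n\<^sub>2 :: nat and p\<^sub>1 p\<^sub>2 :: real
  assumes "prob_space M"
    and "n\<^sub>1 \<ge> 1" and "n\<^sub>2 \<ge> 1"
    and "p\<^sub>1 \<in> {0..1}" and "p\<^sub>2 \<in> {0..1}"
    and "prob_space.indep_var M (count_space UNIV) X\<^sub>1 (count_space UNIV) X\<^sub>2"
    and "distr M (count_space UNIV) X\<^sub>1 = measure_pmf (binomial_pmf n\<^sub>1 p\<^sub>1)"
    and "distr M (count_space UNIV) X\<^sub>2 = measure_pmf (binomial_pmf n\<^sub>2 p\<^sub>2)"
  shows "prob_space.variance M (prop_diff n\<^sub>1 n\<^sub>2 X\<^sub>1 X\<^sub>2)
           = p\<^sub>1 * (1 - p\<^sub>1) / real n\<^sub>1 + p\<^sub>2 * (1 - p\<^sub>2) / real n\<^sub>2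
       \<and> prob_space.expectation M (wald_var n\<^sub>1 n\<^sub>2 X\<^sub>1 X\<^sub>2)
           = prob_space.variance M (prop_diff n\<^sub>1 n\<^sub>2 X\<^sub>1 X\<^sub>2)
             - (p\<^sub>1 * (1 - p\<^sub>1) / (real n\<^sub>1)\<^sup>2 + p\<^sub>2 * (1 - p\<^sub>2) / (real n\<^sub>2)\<^sup>2)
       \<and> (p\<^sub>1 \<notin> {0, 1} \<or> p\<^sub>2 \<notin> {0, 1} \<longrightarrow>
           prob_space.expectation M (wald_var n\<^sub>1 n\<^sub>2 X\<^sub>1 X\<^sub>2)
             < prob_space.variance M (prop_diff n\<^sub>1 n\<^sub>2 X\<^sub>1 X\<^sub>2))
       \<and> (\<forall>n. n\<^sub>1 = n \<and> n\<^sub>2 = n \<longrightarrow>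
           prob_space.expectation M (wald_var n\<^sub>1 n\<^sub>2 X\<^sub>1 X\<^sub>2)
             = (1 - 1 / real n) * prob_space.variance M (prop_diff n\<^sub>1 n\<^sub>2 X\<^sub>1 X\<^sub>2))"
proof -
  interpret prob_space M by fact
  have rv\<^sub>1: "X\<^sub>1 \<in> measurable M (count_space UNIV)"
    using assms(6) by (rule indep_var_rv1)
  have rv\<^sub>2: "X\<^sub>2 \<in> measurable M (count_space UNIV)"
    using assms(6) by (rule indep_var_rv2)
  note group\<^sub>1 = rv\<^sub>1 assms(7,4)
  note group\<^sub>2 = rv\<^sub>2 assms(8,5)
  note int\<^sub>1 = integrable_binomial_distributed[OF group\<^sub>1]
  note int\<^sub>2 = integrable_binomial_distributed[OF group\<^sub>2]
  let ?q\<^sub>1 = "\<lambda>\<omega>. real (X\<^sub>1 \<omega>) / real n\<^sub>1"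
  let ?q\<^sub>2 = "\<lambda>\<omega>. real (X\<^sub>2 \<omega>) / real n\<^sub>2"
  let ?v\<^sub>1 = "p\<^sub>1 * (1 - p\<^sub>1)"
  let ?v\<^sub>2 = "p\<^sub>2 * (1 - p\<^sub>2)"
  let ?bias = "?v\<^sub>1 / (real n\<^sub>1)\<^sup>2 + ?v\<^sub>2 / (real n\<^sub>2)\<^sup>2"
  have "indep_var borel ((\<lambda>k. real k / real n\<^sub>1) \<circ> X\<^sub>1) borel ((\<lambda>k. real k / real n\<^sub>2) \<circ> X\<^sub>2)"
    by (rule indep_var_compose[OF assms(6)]) simp_all
  then have indep: "indep_var borel ?q\<^sub>1 borel ?q\<^sub>2"
    by (simp add: comp_def)
  have "variance (\<lambda>\<omega>. ?q\<^sub>1 \<omega> - ?q\<^sub>2 \<omega>) = variance ?q\<^sub>1 + variance ?q\<^sub>2"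
    by (intro variance_diff_indep indep
        int\<^sub>1[of "\<lambda>k. real k / real n\<^sub>1"] int\<^sub>1[of "\<lambda>k. (real k / real n\<^sub>1)\<^sup>2"]
        int\<^sub>2[of "\<lambda>k. real k / real n\<^sub>2"] int\<^sub>2[of "\<lambda>k. (real k / real n\<^sub>2)\<^sup>2"])
  also have "\<dots> = ?v\<^sub>1 / real n\<^sub>1 + ?v\<^sub>2 / real n\<^sub>2"
    unfolding variance_sample_proportion[OF group\<^sub>1 assms(2)]
      variance_sample_proportion[OF group\<^sub>2 assms(3)] ..
  finally have var: "variance (prop_diff n\<^sub>1 n\<^sub>2 X\<^sub>1 X\<^sub>2) = ?v\<^sub>1 / real n\<^sub>1 + ?v\<^sub>2 / real n\<^sub>2"
    by (simp add: prop_diff_def[abs_def])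
  have "expectation (wald_var n\<^sub>1 n\<^sub>2 X\<^sub>1 X\<^sub>2)
      = expectation (\<lambda>\<omega>. ?q\<^sub>1 \<omega> * (1 - ?q\<^sub>1 \<omega>) / real n\<^sub>1 + ?q\<^sub>2 \<omega> * (1 - ?q\<^sub>2 \<omega>) / real n\<^sub>2)"
    by (simp add: wald_var_def[abs_def] Let_def)
  also have "\<dots> = expectation (\<lambda>\<omega>. ?q\<^sub>1 \<omega> * (1 - ?q\<^sub>1 \<omega>) / real n\<^sub>1)
      + expectation (\<lambda>\<omega>. ?q\<^sub>2 \<omega> * (1 - ?q\<^sub>2 \<omega>) / real n\<^sub>2)"
    by (intro Bochner_Integration.integral_add
        int\<^sub>1[of "\<lambda>k. real k / real n\<^sub>1 * (1 - real k / real n\<^sub>1) / real n\<^sub>1"]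
        int\<^sub>2[of "\<lambda>k. real k / real n\<^sub>2 * (1 - real k / real n\<^sub>2) / real n\<^sub>2"])
  also have "\<dots> = ?v\<^sub>1 / real n\<^sub>1 + ?v\<^sub>2 / real n\<^sub>2 - ?bias"
    unfolding expectation_wald_var_one_sample[OF group\<^sub>1 assms(2)]
      expectation_wald_var_one_sample[OF group\<^sub>2 assms(3)] by simp
  finally have wald: "expectation (wald_var n\<^sub>1 n\<^sub>2 X\<^sub>1 X\<^sub>2)
      = variance (prop_diff n\<^sub>1 n\<^sub>2 X\<^sub>1 X\<^sub>2) - ?bias"
    unfolding var .
  have bias_pos: "?bias > 0" if "p\<^sub>1 \<notin> {0, 1} \<or> p\<^sub>2 \<notin> {0, 1}"
  proof -
    have nonneg: "?v\<^sub>1 / (real n\<^sub>1)\<^sup>2 \<ge> 0" "?v\<^sub>2 / (real n\<^sub>2)\<^sup>2 \<ge> 0"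
      using assms(4,5) by simp_all
    from that show ?thesis
    proof
      assume "p\<^sub>1 \<notin> {0, 1}"
      then have "?v\<^sub>1 / (real n\<^sub>1)\<^sup>2 > 0"
        using assms(2,4) by simp
      with nonneg show ?thesis by linarith
    next
      assume "p\<^sub>2 \<notin> {0, 1}"
      then have "?v\<^sub>2 / (real n\<^sub>2)\<^sup>2 > 0"
        using assms(3,5) by simp
      with nonneg show ?thesis by linarith
    qed
  qed
  have balanced: "expectation (wald_var n\<^sub>1 n\<^sub>2 X\<^sub>1 X\<^sub>2)
      = (1 - 1 / real n) * variance (prop_diff n\<^sub>1 n\<^sub>2 X\<^sub>1 X\<^sub>2)" if "n\<^sub>1 = n \<and> n\<^sub>2 = n" for n
  proof -
    have "?bias = 1 / real n * (?v\<^sub>1 / real n\<^sub>1 + ?v\<^sub>2 / real n\<^sub>2)"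
      using that by (simp add: power2_eq_square distrib_left)
    then show ?thesis
      unfolding wald var by (simp only: left_diff_distrib mult_1_left)
  qed
  show ?thesis
  proof (intro conjI impI allI)
    show "expectation (wald_var n\<^sub>1 n\<^sub>2 X\<^sub>1 X\<^sub>2) < variance (prop_diff n\<^sub>1 n\<^sub>2 X\<^sub>1 X\<^sub>2)"
      if "p\<^sub>1 \<notin> {0, 1} \<or> p\<^sub>2 \<notin> {0, 1}"
      using wald bias_pos[OF that] by linarith
  qed (fact var wald balanced)+
qed

end
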